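(* Let $\mathsf{f}(\mathbf{x};\theta)$ be the merit function (defined in the context) of the parametrized complementarity problem $\mathbb{K}\ni\mathbf{x}\perp\mathbf{F}(\mathbf{x};\theta)\in\mathbb{K}^*$, and let $\mathbf{x}^*=\mathbf{x}^*(\hat\theta)$ be a known solution for $\theta=\hat\theta$ which is an isolated global minimum of $\mathsf{f}(\cdot\,;\hat\theta)$. Assume that at this known solution 1. the condition number of the Hessian $\mathcal{H}=\nabla^2_{\mathbf{x}}\mathsf{f}(\mathbf{x}^*;\hat\theta)$ is finite, equal to $\kappa_H$; 2. the Hessian of $\mathsf{f}$ is Lipschitz continuous (in both $\mathbf{x}$ and $\theta$) near $(\mathbf{x}^*,\hat\theta)$ with a Lipschitz constant $\mathcal{L}$. For a perturbation $\Delta\theta$ of $\hat\theta$ with $\|\Delta\theta\|=\epsilon$, let $\Delta\mathbf{x}$ be the corresponding change in the solution, i.e. $\nabla_{\mathbf{x}}\mathsf{f}(\mathbf{x}^*+\Delta\mathbf{x};\hat\theta+\Delta\theta)=0$ with $\Delta\mathbf{x}\to0$ as $\Delta\theta\to0$, and let $\Delta\mathbf{x}_{\mathrm{lin}}$ be its linear approximation, defined by $$\mathcal{H}\,\Delta\mathbf{x}_{\mathrm{lin}}=-\mathcal{J}\,\Delta\theta,\qquad \mathcal{J}=\nabla_\theta\nabla_{\mathbf{x}}\mathsf{f}(\mathbf{x}^*;\hat\theta).$$ Then the error of the linear approximation is $o(\epsilon)$: $\ \|\Delta\mathbf{x}-\Delta\mathbf{x}_{\mathrm{lin}}\|=o(\epsilon)$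 as $\epsilon\to0$.
   Context: Setting: $\mathcal{I}\subseteq\{1,\dots,n\}$, $\mathbb{K}=\{\mathbf{x}\in\mathbb{R}^n:\mathbf{x}_i\ge0\ \forall i\in\mathcal{I}\}$, $\mathbb{K}^*=\{\mathbf{x}:\mathbf{v}^T\mathbf{x}\ge0\ \forall\mathbf{v}\in\mathbb{K}\}$, and $\mathbf{F}:\mathbb{R}^n\times\mathbb{R}^m\to\mathbb{R}^n$ is twice continuously differentiable in $\mathbf{x}$ and $\theta$ over an open set containing $\mathbb{K}$. The problem $\mathbb{K}\ni\mathbf{x}\perp\mathbf{F}(\mathbf{x};\theta)\in\mathbb{K}^*$ asks for $\mathbf{x}\in\mathbb{K}$ with $\mathbf{F}(\mathbf{x};\theta)\in\mathbb{K}^*$ and $\mathbf{x}^T\mathbf{F}(\mathbf{x};\theta)=0$. A C-function is $\psi:\mathbb{R}^2\to\mathbb{R}$ with $\psi(a,b)=0\iff a\ge0,\ b\ge0,\ ab=0$. The C-function $\psi$ used is assumed twice differentiable (with finite first and second derivatives) at every point of $\{\psi=0\}\setminus\{(0,0)\}$ and to satisfy $\lim_{(a,b)\to(0,0)}\psi^2\,\partial^2\psi/\partial a\partial b=0$. With $\mathcal{Z}=\{i\in\mathcal{I}:\mathbf{x}^*_i=\mathbf{F}_i(\mathbf{x}^*;\hat\theta)=0\}$, put $\Phi_i(\mathbf{x};\theta)=\mathbf{F}_i(\mathbf{x};\theta)$ if $i\notin\mathcal{I}$, $\Phi_i(\mathbf{x};\theta)=\psi^2(\mathbf{x}_i,\mathbf{F}_i(\mathbf{x};\theta))$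 if $i\in\mathcal{Z}$, and $\Phi_i(\mathbf{x};\theta)=\psi(\mathbf{x}_i,\mathbf{F}_i(\mathbf{x};\theta))$ otherwise; the merit function is $\mathsf{f}(\mathbf{x};\theta)=\tfrac12\|\Phi(\mathbf{x};\theta)\|_2^2$. A minimum is isolated if it is the only minimum in some neighborhood of itself. A finite condition number means in particular that $\mathcal{H}$ is invertible. "Hessian of $\mathsf{f}$" in assumption 2 refers to the second derivatives $\nabla^2_{\mathbf{x}}\mathsf{f}$ and $\nabla_\theta\nabla_{\mathbf{x}}\mathsf{f}$. *)

theory Defs
  imports "HOL-Analysis.Analysis" "HOL-Library.Landau_Symbols"
begin

definition twice_differentiable_at ::
  "('a::real_normed_vector \<Rightarrow> 'b::real_normed_vector) \<Rightarrow> 'a \<Rightarrow> bool"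
where
  "twice_differentiable_at f p \<longleftrightarrow>
     (\<exists>D :: 'a \<Rightarrow> 'a \<Rightarrow>\<^sub>L 'b.
        (\<forall>\<^sub>F q in nhds p. (f has_derivative blinfun_apply (D q)) (at q)) \<and>
        D differentiable (at p))"

definition twice_continuously_differentiable_on ::
  "('a::real_normed_vector \<Rightarrow> 'b::real_normed_vector) \<Rightarrow> 'a set \<Rightarrow> bool"
where
  "twice_continuously_differentiable_on f S \<longleftrightarrow>
     (\<exists>(D :: 'a \<Rightarrow> 'a \<Rightarrow>\<^sub>L 'b) (D2 :: 'a \<Rightarrow> 'a \<Rightarrow>\<^sub>L ('a \<Rightarrow>\<^sub>L 'b)).
        (\<forall>z\<in>S. (f has_derivative blinfun_apply (D z)) (at z)) \<and>
        (\<forall>z\<in>S. (D has_derivative blinfun_apply (D2 z)) (at z)) \<and>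
        continuous_on S D2)"

definition nonneg_cone :: "'n::finite set \<Rightarrow> (real^'n) set" where
  "nonneg_cone I = {x. \<forall>i\<in>I. 0 \<le> x $ i}"

definition dual_cone :: "'a::real_inner set \<Rightarrow> 'a set" where
  "dual_cone K = {x. \<forall>v\<in>K. 0 \<le> v \<bullet> x}"

definition solves_complementarity ::
  "(real^'n::finite) set \<Rightarrow> (real^'n \<Rightarrow> real^'n) \<Rightarrow> real^'n \<Rightarrow> bool"
where
  "solves_complementarity K G x \<longleftrightarrow> x \<in> K \<and> G x \<in> dual_cone K \<and> x \<bullet> G x = 0"

definition C_function :: "(real \<times> real \<Rightarrow> real) \<Rightarrow> bool" where
  "C_function \<psi> \<longleftrightarrow> (\<forall>a b. \<psi> (a, b) = 0 \<longleftrightarrow> 0 \<le> a \<and> 0 \<le> b \<and> a * b = 0)"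

definition mixed_partial :: "(real \<times> real \<Rightarrow> real) \<Rightarrow> real \<times> real \<Rightarrow> real" where
  "mixed_partial \<psi> = (\<lambda>(a, b). deriv (\<lambda>s. deriv (\<lambda>t. \<psi> (s, t)) b) a)"

text \<open>The points at which the iterated partial derivative exists, so that the value of
  \<^const>\<open>mixed_partial\<close> is meaningful.\<close>

definition mixed_partial_domain :: "(real \<times> real \<Rightarrow> real) \<Rightarrow> (real \<times> real) set" where
  "mixed_partial_domain \<psi> =
     {(a, b). (\<forall>\<^sub>F s in nhds a. (\<lambda>t. \<psi> (s, t)) field_differentiable (at b)) \<and>
              (\<lambda>s. deriv (\<lambda>t. \<psi> (s, t)) b) field_differentiable (at a)}"

text \<open>The limit at the origin is taken over the points at which the mixed partial exists:
  a C-function such as \<open>min\<close> is not differentiable on the whole of a punctured neighbourhood.\<close>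

definition admissible_C_function :: "(real \<times> real \<Rightarrow> real) \<Rightarrow> bool" where
  "admissible_C_function \<psi> \<longleftrightarrow>
     C_function \<psi> \<and>
     (\<forall>p. \<psi> p = 0 \<and> p \<noteq> (0, 0) \<longrightarrow> twice_differentiable_at \<psi> p) \<and>
     ((\<lambda>p. (\<psi> p)\<^sup>2 * mixed_partial \<psi> p) \<longlongrightarrow> 0) (at (0, 0) within mixed_partial_domain \<psi>)"

definition degenerate_set ::
  "'n::finite set \<Rightarrow> (real^'n \<Rightarrow> real^'m::finite \<Rightarrow> real^'n) \<Rightarrow> real^'n \<Rightarrow> real^'m \<Rightarrow> 'n set"
where
  "degenerate_set I F xs \<theta>h = {i \<in> I. xs $ i = 0 \<and> F xs \<theta>h $ i = 0}"

text \<open>The map \<open>\<Phi>\<close> and the merit function depend on the known solution \<open>xs\<close> at \<open>\<theta>h\<close>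
  through the index set on which the C-function is squared.\<close>

definition merit_map ::
  "'n::finite set \<Rightarrow> (real \<times> real \<Rightarrow> real) \<Rightarrow> (real^'n \<Rightarrow> real^'m::finite \<Rightarrow> real^'n) \<Rightarrow>
   real^'n \<Rightarrow> real^'m \<Rightarrow> real^'n \<Rightarrow> real^'m \<Rightarrow> real^'n"
where
  "merit_map I \<psi> F xs \<theta>h x \<theta> =
     (\<chi> i. if i \<notin> I then F x \<theta> $ i
           else if i \<in> degenerate_set I F xs \<theta>h then (\<psi> (x $ i, F x \<theta> $ i))\<^sup>2
           else \<psi> (x $ i, F x \<theta> $ i))"

definition merit ::
  "'n::finite set \<Rightarrow> (real \<times> real \<Rightarrow> real) \<Rightarrow> (real^'n \<Rightarrow> real^'m::finite \<Rightarrow> real^'n) \<Rightarrow>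
   real^'n \<Rightarrow> real^'m \<Rightarrow> real^'n \<Rightarrow> real^'m \<Rightarrow> real"
where
  "merit I \<psi> F xs \<theta>h x \<theta> = 1/2 * (norm (merit_map I \<psi> F xs \<theta>h x \<theta>))\<^sup>2"

abbreviation global_minimum :: "('a \<Rightarrow> real) \<Rightarrow> 'a \<Rightarrow> bool" where
  "global_minimum g x \<equiv> is_arg_min g (\<lambda>_. True) x"

definition isolated_global_minimum :: "('a::topological_space \<Rightarrow> real) \<Rightarrow> 'a \<Rightarrow> bool" where
  "isolated_global_minimum g x \<longleftrightarrow>
     global_minimum g x \<and>
     (\<exists>N. open N \<and> x \<in> N \<and> (\<forall>y\<in>N. global_minimum g y \<longrightarrow> y = x))"

definition grad_x :: "('a::real_inner \<Rightarrow> 'b \<Rightarrow> real) \<Rightarrow> 'a \<Rightarrow> 'b \<Rightarrow> 'a" where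
  "grad_x f x \<theta> = (THE g. GDERIV (\<lambda>y. f y \<theta>) x :> g)"

definition hess_x ::
  "(real^'n::finite \<Rightarrow> real^'m::finite \<Rightarrow> real) \<Rightarrow> real^'n \<Rightarrow> real^'m \<Rightarrow> real^'n^'n"
where
  "hess_x f x \<theta> = jacobian (\<lambda>y. grad_x f y \<theta>) (at x)"

definition hess_x\<theta> ::
  "(real^'n::finite \<Rightarrow> real^'m::finite \<Rightarrow> real) \<Rightarrow> real^'n \<Rightarrow> real^'m \<Rightarrow> real^'m^'n"
where
  "hess_x\<theta> f x \<theta> = jacobian (\<lambda>t. grad_x f x t) (at \<theta>)"

definition hessian_lipschitz_near ::
  "real \<Rightarrow> (real^'n::finite \<Rightarrow> real^'m::finite \<Rightarrow> real) \<Rightarrow> real^'n \<Rightarrow> real^'m \<Rightarrow> bool"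
where
  "hessian_lipschitz_near L f xs \<theta>h \<longleftrightarrow>
     (\<exists>W. open W \<and> (xs, \<theta>h) \<in> W \<and>
        (\<forall>(x, \<theta>)\<in>W. (\<lambda>y. f y \<theta>) differentiable (at x) \<and>
                     (\<lambda>y. grad_x f y \<theta>) differentiable (at x) \<and>
                     (\<lambda>t. grad_x f x t) differentiable (at \<theta>)) \<and>
        L-lipschitz_on W (\<lambda>(x, \<theta>). hess_x f x \<theta>) \<and>
        L-lipschitz_on W (\<lambda>(x, \<theta>). hess_x\<theta> f x \<theta>))"

definition condition_number :: "real^'n^'n::finite \<Rightarrow> ereal" where
  "condition_number A =
     (if invertible A then ereal (onorm ((*v) A) * onorm ((*v) (matrix_inv A))) else \<infinity>)"

end

theory Submission
  imports Defs
begin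

text \<open>Put \<open>g = \<nabla>\<^sub>x f\<close>. At the global minimum \<open>xs\<close> the gradient vanishes, and since the
  partial derivatives of \<open>g\<close> are continuous near \<open>(xs, \<theta>h)\<close>, \<open>g\<close> is jointly differentiable
  there with derivative \<open>(u, v) \<mapsto> H u + J v\<close>. Hence
  \<open>0 = g (xs + \<Delta>x, \<theta>h + \<Delta>\<theta>) = H (\<Delta>x - \<Delta>x_lin) + o(\<parallel>\<Delta>x\<parallel> + \<parallel>\<Delta>\<theta>\<parallel>)\<close>.
  As \<open>H\<close> is invertible and \<open>\<parallel>\<Delta>x\<parallel> \<le> \<parallel>\<Delta>x - \<Delta>x_lin\<parallel> + O(\<parallel>\<Delta>\<theta>\<parallel>)\<close>, the part of the
  remainder that is proportional to the error is absorbed on the left.\<close>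

lemma grad_x_eq_0_if_global_minimum:
  fixes f :: "'a::real_inner \<Rightarrow> 'b \<Rightarrow> real"
  assumes "(\<lambda>y. f y \<theta>) differentiable (at x)" and "global_minimum (\<lambda>y. f y \<theta>) x"
  shows "grad_x f x \<theta> = 0"
proof -
  obtain D where D: "((\<lambda>y. f y \<theta>) has_derivative D) (at x)"
    using assms(1) by (auto simp: differentiable_def)
  have "D = (\<lambda>v. 0)"
    using assms(2) by (intro differential_zero_maxmin[OF UNIV_I open_UNIV D])
      (auto simp: is_arg_min_linorder)
  with D have zero: "GDERIV (\<lambda>y. f y \<theta>) x :> 0"
    by (simp add: gderiv_def)
  \<comment> \<open>\<open>grad_x\<close> is a definite description, so a vanishing derivative
    determines its value only once uniqueness of the gradient is checked.\<close>
  show ?thesis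
    unfolding grad_x_def
  proof (rule the_equality)
    show "GDERIV (\<lambda>y. f y \<theta>) x :> 0" by (fact zero)
  next
    fix g assume "GDERIV (\<lambda>y. f y \<theta>) x :> g"
    with zero have "(\<lambda>h. h \<bullet> 0) = (\<lambda>h. h \<bullet> g)"
      unfolding gderiv_def by (rule has_derivative_unique)
    then have "g \<bullet> g = 0"
      by (metis inner_zero_right)
    then show "g = 0" by simp
  qed
qed

text \<open>Linear maps out of a finite-dimensional space are continuous, so this carries continuity
  of a Jacobian matrix over to the bounded operators in which
  \<open>has_derivative_partialsI\<close> is phrased.\<close>

lemma linear_Blinfun_matrix_vector_mult:
  "linear (\<lambda>M :: real^'m::finite^'n::finite. Blinfun ((*v) M))"
  by (intro linearI blinfun_eqI)
    (simp_all add: bounded_linear_Blinfun_apply blinfun.add_left blinfun.scaleR_left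
      matrix_vector_mult_add_rdistrib scaleR_matrix_vector_assoc)

text \<open>Split the increment as (g y s - g y t) + (g y t - g x t). The mean value inequality and
  continuity of the partial in the second variable control the first bracket; for the second
  bracket, differentiability at the single point \<open>x\<close> is enough.\<close>

lemma has_derivative_jacobian_partials:
  fixes g :: "real^'n::finite \<Rightarrow> real^'m::finite \<Rightarrow> real^'k::finite"
  assumes "open W" and xt: "(x, t) \<in> W"
    and gx: "(\<lambda>y. g y t) differentiable (at x)"
    and gt: "\<And>y s. (y, s) \<in> W \<Longrightarrow> (\<lambda>s. g y s) differentiable (at s)"
    and cont: "continuous_on W (\<lambda>(y, s). jacobian (\<lambda>s. g y s) (at s))"
  shows "((\<lambda>(y, s). g y s) has_derivative
    (\<lambda>(u, v). jacobian (\<lambda>y. g y t) (at x) *v u + jacobian (\<lambda>s. g x s) (at t) *v v)) (at (x, t))"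
proof -
  obtain X Y' where XY': "open X" "open Y'" "x \<in> X" "t \<in> Y'" "X \<times> Y' \<subseteq> W"
    using open_prod_elim[OF \<open>open W\<close> xt] by (metis mem_Sigma_iff)
  then obtain r where r: "0 < r" "ball t r \<subseteq> Y'"
    using open_contains_ball by metis
  \<comment> \<open>The mean value inequality in the second variable runs along segments, so that
    factor of the box is shrunk to a convex ball.\<close>
  define Y where "Y = ball t r"
  have Y: "open Y" "t \<in> Y" "convex Y" and sub: "X \<times> Y \<subseteq> W"
    using r XY' by (auto simp: Y_def)
  define B where "B = (\<lambda>y s. Blinfun ((*v) (jacobian (\<lambda>s. g y s) (at s))))"
  have B_apply: "blinfun_apply (B y s) = (*v) (jacobian (\<lambda>s. g y s) (at s))" for y s
    by (simp add: B_def bounded_linear_Blinfun_apply)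
  have at_eq: "at (x, t) within X \<times> Y = at (x, t)"
    using XY' Y by (intro at_within_open) (auto intro: open_Times)
  have "continuous_on W (\<lambda>p. Blinfun ((*v) (case p of (y, s) \<Rightarrow> jacobian (\<lambda>s. g y s) (at s))))"
    by (rule linear_continuous_on_compose[OF cont linear_Blinfun_matrix_vector_mult])
  then have "continuous_on W (\<lambda>(y, s). B y s)"
    by (simp add: B_def case_prod_unfold)
  then have "continuous (at (x, t) within X \<times> Y) (\<lambda>(y, s). B y s)"
    using \<open>open W\<close> xt by (simp add: at_eq continuous_on_eq_continuous_at)
  moreover have "((\<lambda>s. g y s) has_derivative blinfun_apply (B y s)) (at s within Y)"
    if "y \<in> X" "s \<in> Y" for y s
    using gt[of y s] that sub unfolding jacobian_works B_apply
    by (blast intro: has_derivative_at_withinI)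
  moreover have "((\<lambda>y. g y t) has_derivative (*v) (jacobian (\<lambda>y. g y t) (at x))) (at x within X)"
    using gx unfolding jacobian_works by (rule has_derivative_at_withinI)
  ultimately have "((\<lambda>(y, s). g y s) has_derivative
      (\<lambda>(u, v). jacobian (\<lambda>y. g y t) (at x) *v u + B x t v)) (at (x, t) within X \<times> Y)"
    using Y by (intro has_derivative_partialsI)
  then show ?thesis
    by (simp add: at_eq B_apply)
qed

text \<open>The solution branch \<open>X\<close> is given, so no implicit function theorem is
  invoked and differentiability of \<open>g\<close> at one point suffices. The lower bound
  \<open>c\<close> stands in for a bounded inverse of \<open>A\<close>.\<close>

lemma implicit_solution_linearization_error:
  fixes g :: "'a::real_normed_vector \<times> 'b::real_normed_vector \<Rightarrow> 'c::real_normed_vector"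
  assumes deriv: "(g has_derivative (\<lambda>(u, v). A u + B v)) (at (x, t))"
    and g0: "g (x, t) = 0"
    and A: "linear A" and "0 < c" and A_lower: "\<And>u. c * norm u \<le> norm (A u)"
    and B: "bounded_linear B"
    and sol: "\<forall>\<^sub>F d in at 0. g (x + X d, t + d) = 0"
    and lim: "(X \<longlongrightarrow> 0) (at 0)"
    and lin: "\<And>d. A (Y d) = - B d"
  shows "(\<lambda>d. norm (X d - Y d)) \<in> o[at 0](\<lambda>d. norm d)"
proof (rule landau_o.smallI)
  fix \<epsilon> :: real assume "0 < \<epsilon>"
  obtain K where K: "0 < K" "\<And>v. norm (B v) \<le> norm v * K"
    using bounded_linear.pos_bounded[OF B] by blast
  \<comment> \<open>\<open>K / c\<close> bounds the growth of \<open>Y\<close>; the extra 1 accounts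
    for the term \<open>norm d\<close> in the remainder.\<close>
  define M where "M = K / c + 1"
  have "0 < M" using K \<open>0 < c\<close> by (simp add: M_def add_pos_pos)
  \<comment> \<open>The first entry lets half of \<open>c * norm (X d - Y d)\<close> absorb the
    remainder; the second leaves exactly \<epsilon> after division by \<open>c / 2\<close>.\<close>
  define \<eta> where "\<eta> = min (c / 2) (c * \<epsilon> / (2 * M))"
  have \<eta>: "0 < \<eta>" "\<eta> \<le> c / 2" "\<eta> * M \<le> c / 2 * \<epsilon>"
    using \<open>0 < c\<close> \<open>0 < \<epsilon>\<close> \<open>0 < M\<close> by (auto simp: \<eta>_def min_def field_simps)
  obtain \<delta> where \<delta>: "0 < \<delta>" and
    small: "\<And>p. norm (p - (x, t)) < \<delta> \<Longrightarrow>
      norm (g p - g (x, t) - (case p - (x, t) of (u, v) \<Rightarrow> A u + B v)) \<le> \<eta> * norm (p - (x, t))"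
    using deriv \<eta>(1) unfolding has_derivative_at_alt by blast
  have "((\<lambda>d. norm (X d, d)) \<longlongrightarrow> norm (0 :: 'a, 0 :: 'b)) (at 0)"
    by (intro tendsto_intros lim)
  then have "\<forall>\<^sub>F d in at 0. norm (X d, d) < \<delta>"
    using \<delta> by (intro order_tendstoD) (auto simp: zero_prod_def[symmetric])
  with sol show "\<forall>\<^sub>F d in at 0. norm (norm (X d - Y d)) \<le> \<epsilon> * norm (norm d)"
  proof eventually_elim
    case (elim d)
    \<comment> \<open>Both values of \<open>g\<close> in the differentiability estimate vanish, so
      only its linear part remains.\<close>
    have "norm (A (X d) + B d) \<le> \<eta> * norm (X d, d)"
      using small[of "(x + X d, t + d)"] elim g0 by (simp add: norm_minus_commute add.commute)
    also have "\<dots> \<le> \<eta> * (norm (X d) + norm d)"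
      using \<eta>(1) by (intro mult_left_mono norm_Pair_le) auto
    finally have "norm (A (X d) + B d) \<le> \<eta> * (norm (X d) + norm d)" .
    moreover have "A (X d - Y d) = A (X d) + B d"
      by (simp add: linear_diff[OF A] lin)
    ultimately have "c * norm (X d - Y d) \<le> \<eta> * (norm (X d) + norm d)"
      using A_lower[of "X d - Y d"] by simp
    also have "norm (X d) + norm d \<le> norm (X d - Y d) + M * norm d"
    proof -
      have "c * norm (Y d) \<le> norm d * K"
        using A_lower[of "Y d"] K(2)[of d] by (simp add: lin)
      then have "norm (Y d) \<le> K / c * norm d"
        using \<open>0 < c\<close> by (simp add: field_simps)
      moreover have "norm (X d) \<le> norm (X d - Y d) + norm (Y d)"
        using norm_triangle_sub[of "X d" "Y d"] by simp
      ultimately show ?thesis by (simp add: M_def algebra_simps)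
    qed
    also have "\<eta> * (norm (X d - Y d) + M * norm d)
        = \<eta> * norm (X d - Y d) + (\<eta> * M) * norm d"
      by (simp add: algebra_simps)
    also have "\<dots> \<le> c / 2 * norm (X d - Y d) + (c / 2 * \<epsilon>) * norm d"
      using \<eta> by (intro add_mono mult_right_mono) auto
    finally have "c / 2 * norm (X d - Y d) \<le> c / 2 * (\<epsilon> * norm d)"
      using \<eta>(1) by (simp add: algebra_simps)
    then show ?case
      using \<open>0 < c\<close> by simp
  qed
qed

text \<open>An injective linear map has a positive minimum of its norm on the compact unit sphere;
  homogeneity does the rest.\<close>

lemma invertible_matrix_lower_bound:
  fixes A :: "real^'n::finite^'n"
  assumes "invertible A"
  obtains c where "0 < c" "\<And>u. c * norm u \<le> norm (A *v u)"
  using linear_inj_bounded_below_pos[of "(*v) A"] inj_matrix_vector_mult[OF assms]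
  by (metis matrix_vector_mul_linear)

theorem theorem12:
  fixes I :: "'n::finite set"
    and F :: "real^'n \<Rightarrow> real^'m::finite \<Rightarrow> real^'n"
    and U :: "(real^'n) set"
    and \<psi> :: "real \<times> real \<Rightarrow> real"
    and xs :: "real^'n" and \<theta>h :: "real^'m"
    and \<kappa>\<^sub>H L :: real
    and f :: "real^'n \<Rightarrow> real^'m \<Rightarrow> real"
    and H :: "real^'n^'n" and J :: "real^'m^'n"
    and \<Delta>x \<Delta>x_lin :: "real^'m \<Rightarrow> real^'n"
  assumes "open U" and "nonneg_cone I \<subseteq> U"
    and "twice_continuously_differentiable_on (\<lambda>(x, \<theta>). F x \<theta>) (U \<times> UNIV)"
    and "admissible_C_function \<psi>"
    and f_def: "f = merit I \<psi> F xs \<theta>h"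
    and "solves_complementarity (nonneg_cone I) (\<lambda>x. F x \<theta>h) xs"
    and "isolated_global_minimum (\<lambda>x. f x \<theta>h) xs"
    and H_def: "H = hess_x f xs \<theta>h" and J_def: "J = hess_x\<theta> f xs \<theta>h"
    and "condition_number H = ereal \<kappa>\<^sub>H"
    and "hessian_lipschitz_near L f xs \<theta>h"
    and "\<forall>\<^sub>F \<Delta>\<theta> in at 0. grad_x f (xs + \<Delta>x \<Delta>\<theta>) (\<theta>h + \<Delta>\<theta>) = 0"
    and "(\<Delta>x \<longlongrightarrow> 0) (at 0)"
    and "\<And>\<Delta>\<theta>. H *v \<Delta>x_lin \<Delta>\<theta> = - (J *v \<Delta>\<theta>)"
  shows "(\<lambda>\<Delta>\<theta>. norm (\<Delta>x \<Delta>\<theta> - \<Delta>x_lin \<Delta>\<theta>)) \<in> o[at 0](\<lambda>\<Delta>\<theta>. norm \<Delta>\<theta>)"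
proof -
  obtain W where W: "open W" "(xs, \<theta>h) \<in> W"
    and diff: "\<And>x \<theta>. (x, \<theta>) \<in> W \<Longrightarrow> (\<lambda>y. f y \<theta>) differentiable (at x) \<and>
      (\<lambda>y. grad_x f y \<theta>) differentiable (at x) \<and> (\<lambda>t. grad_x f x t) differentiable (at \<theta>)"
    and lip: "L-lipschitz_on W (\<lambda>(x, \<theta>). hess_x\<theta> f x \<theta>)"
    using \<open>hessian_lipschitz_near L f xs \<theta>h\<close> unfolding hessian_lipschitz_near_def by blast
  \<comment> \<open>The Lipschitz bound is joint in both variables, which gives the joint continuity
    needed for differentiability of the gradient on the product.\<close>
  have "continuous_on W (\<lambda>(x, \<theta>). jacobian (\<lambda>t. grad_x f x t) (at \<theta>))"
    using lipschitz_on_continuous_on[OF lip] by (simp add: hess_x\<theta>_def)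
  then have deriv: "((\<lambda>(x, \<theta>). grad_x f x \<theta>) has_derivative (\<lambda>(u, v). H *v u + J *v v))
      (at (xs, \<theta>h))"
    unfolding H_def J_def hess_x_def hess_x\<theta>_def
    using diff W by (intro has_derivative_jacobian_partials) auto
  have grad_0: "grad_x f xs \<theta>h = 0"
    using diff[OF W(2)] \<open>isolated_global_minimum (\<lambda>x. f x \<theta>h) xs\<close>
    by (intro grad_x_eq_0_if_global_minimum) (auto simp: isolated_global_minimum_def)
  \<comment> \<open>A singular matrix has condition number \<infinity>, which is no real
    value.\<close>
  have "invertible H"
    using \<open>condition_number H = ereal \<kappa>\<^sub>H\<close> by (auto simp: condition_number_def split: if_splits)
  then obtain c where c: "0 < c" "\<And>u. c * norm u \<le> norm (H *v u)"
    by (rule invertible_matrix_lower_bound) blast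
  show ?thesis
    by (rule implicit_solution_linearization_error[OF deriv _ _ c]) (use assms grad_0 in auto)
qed

end
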